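(* Let $A,B,C$ be subsets of a reflexive Banach space $X$, where $C$ is closed and convex and $B$ is nonempty, and let $B_{\infty}$ be the asymptotic cone of $B$ with respect to the weak topology. Assume that $0\notin\mathfrak{B}_B$, that $B_{\infty}\subset\operatorname{recc}C=V$, and that $V$ is a pointed cone. Then the inclusion $A+B\subset\operatorname{cl}_{\mathrm{weak}}(B+C)$ implies $A\subset C$.
   Context: Banach spaces are real. $A+B=\{a+b:a\in A,b\in B\}$; $\operatorname{cl}_{\mathrm{weak}}$ is closure in the weak topology. The recession cone of $C\subset X$ is $\operatorname{recc}C=\{x\in X: c+tx\in C\text{ for all }c\in C,\ t\geqslant 0\}$. A cone $V$ is pointed if $V\cap(-V)=\{0\}$. The asymptotic cone of $B$ with respect to the weak topology is $B_{\infty}=\{\text{weak-}\lim_{n\to\infty}t_nx_n: (x_n)\subset B,\ (t_n)\subset\mathbb{R},\ t_n\downarrow 0\}$ (sequences for which the weak limit exists). $\mathfrak{B}_B$ is the set of all $\xi\in X$ for which there exists a sequence $(x_n)\subset B$ with $\|x_n\|\to\infty$ and $x_n/\|x_n\|\to\xi$ weakly. *)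

theory Defs
  imports "HOL-Analysis.Analysis"
begin

definition weak_topology :: "'a::real_normed_vector topology" where
  "weak_topology =
     topology_generated_by {blinfun_apply f -` U | (f :: 'a \<Rightarrow>\<^sub>L real) U. open U}"

lemma openin_weak_topology_vimage:
  fixes f :: "'a::real_normed_vector \<Rightarrow>\<^sub>L real"
  assumes "open U"
  shows "openin weak_topology (blinfun_apply f -` U)"
  unfolding weak_topology_def by (rule topology_generated_by_Basis) (use assms in blast)

lemma topspace_weak_topology [simp]:
  "topspace (weak_topology :: 'a::real_normed_vector topology) = UNIV"
  using openin_subset[OF openin_weak_topology_vimage[OF open_UNIV, of "0 :: 'a \<Rightarrow>\<^sub>L real"]]
  by auto

lemma limitin_weak_topology_iff:
  fixes x :: "'b \<Rightarrow> 'a::real_normed_vector"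
  shows "limitin weak_topology x l F \<longleftrightarrow>
    (\<forall>f :: 'a \<Rightarrow>\<^sub>L real. ((\<lambda>n. blinfun_apply f (x n)) \<longlongrightarrow> blinfun_apply f l) F)"
proof (intro iffI allI)
  fix f :: "'a \<Rightarrow>\<^sub>L real"
  assume lim: "limitin weak_topology x l F"
  show "((\<lambda>n. blinfun_apply f (x n)) \<longlongrightarrow> blinfun_apply f l) F"
  proof (rule topological_tendstoI)
    fix U :: "real set"
    assume "open U" "blinfun_apply f l \<in> U"
    then have "openin weak_topology (blinfun_apply f -` U)" "l \<in> blinfun_apply f -` U"
      by (auto intro: openin_weak_topology_vimage)
    with lim have "eventually (\<lambda>n. x n \<in> blinfun_apply f -` U) F"
      unfolding limitin_def by blast
    then show "eventually (\<lambda>n. blinfun_apply f (x n) \<in> U) F" by simp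
  qed
next
  assume lim: "\<forall>f :: 'a \<Rightarrow>\<^sub>L real. ((\<lambda>n. blinfun_apply f (x n)) \<longlongrightarrow> blinfun_apply f l) F"
  have "eventually (\<lambda>n. x n \<in> W) F"
    if "generate_topology_on {blinfun_apply f -` U | (f :: 'a \<Rightarrow>\<^sub>L real) U. open U} W" "l \<in> W" for W
    using that
  proof (induction rule: generate_topology_on.induct)
    case (Int a b)
    then show ?case by (auto intro: eventually_conj)
  next
    case (UN K)
    then obtain k where k: "k \<in> K" "l \<in> k" by blast
    with UN have "eventually (\<lambda>n. x n \<in> k) F" by blast
    then show ?case by (rule eventually_mono) (use k in blast)
  next
    case (Basis s)
    then obtain f :: "'a \<Rightarrow>\<^sub>L real" and U where "s = blinfun_apply f -` U" "open U" by blast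
    with Basis lim show ?case by (auto dest: topological_tendstoD)
  qed simp
  then show "limitin weak_topology x l F"
    unfolding limitin_def weak_topology_def openin_topology_generated_by_iff
    by (simp add: weak_topology_def[symmetric])
qed

lift_definition bidual_embedding :: "'a::real_normed_vector \<Rightarrow> ('a \<Rightarrow>\<^sub>L real) \<Rightarrow>\<^sub>L real"
  is "\<lambda>x f. blinfun_apply f x"
  by (rule blinfun.bounded_linear_left)

definition reflexive_space :: "'a::banach itself \<Rightarrow> bool" where
  "reflexive_space _ \<longleftrightarrow> surj (bidual_embedding :: 'a \<Rightarrow> ('a \<Rightarrow>\<^sub>L real) \<Rightarrow>\<^sub>L real)"

definition recc :: "'a::real_vector set \<Rightarrow> 'a set" where
  "recc C = {x. \<forall>c\<in>C. \<forall>t\<ge>0. c + t *\<^sub>R x \<in> C}"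

text \<open>The set of negatives is written as an image, since unary minus on sets is the complement.\<close>

definition pointed_cone :: "'a::real_vector set \<Rightarrow> bool" where
  "pointed_cone V \<longleftrightarrow> cone V \<and> V \<inter> uminus ` V = {0}"

text \<open>The sequence \<open>t\<close> decreases (not necessarily strictly) to \<open>0\<close>; in particular all its
  terms are nonnegative. Requiring them to be positive gives the same set: if some term of \<open>t\<close> is
  zero then so are all later ones, the limit is \<open>0\<close>, and \<open>0\<close> is also the limit obtained
  from a constant sequence in \<open>B\<close> and \<open>t n = 1 / (n + 1)\<close>.\<close>

definition weak_asymptotic_cone :: "'a::real_normed_vector set \<Rightarrow> 'a set" where
  "weak_asymptotic_cone B =
     {y. \<exists>(x :: nat \<Rightarrow> 'a) (t :: nat \<Rightarrow> real).
        range x \<subseteq> B \<and> decseq t \<and> t \<longlonglongrightarrow> 0 \<and>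
        limitin weak_topology (\<lambda>n. t n *\<^sub>R x n) y sequentially}"

definition weak_directions_at_infinity :: "'a::real_normed_vector set \<Rightarrow> 'a set" where
  "weak_directions_at_infinity B =
     {\<xi>. \<exists>x :: nat \<Rightarrow> 'a.
        range x \<subseteq> B \<and> filterlim (\<lambda>n. norm (x n)) at_top sequentially \<and>
        limitin weak_topology (\<lambda>n. x n /\<^sub>R norm (x n)) \<xi> sequentially}"

end

theory Submission
  imports Defs "HOL-Complex_Analysis.Great_Picard"
begin

text \<open>
  For a bounded set \<open>B\<close> the cancellation law is a separation argument: if \<open>a \<in> A\<close> is not in \<open>C\<close>, a
  functional \<open>f\<close> with \<open>f \<ge> f a + \<delta>\<close> on \<open>C\<close> satisfies \<open>f \<ge> inf f(B) + f a + \<delta>\<close> on \<open>B + C\<close>, hence on its weak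
  closure and on \<open>a + B\<close>, which contradicts the definition of the infimum. All that this requires of
  \<open>B\<close> is that \<open>f\<close> be bounded below on it, and the hypotheses at infinity allow \<open>f\<close> to be chosen so.

  Let \<open>U n\<close> be the set of directions \<open>b / norm b\<close> of the points \<open>b \<in> B\<close> with \<open>norm b \<ge> n\<close>. If \<open>f\<close> separates \<open>0\<close>
  from the convex hull of \<open>(C - a) \<union> U n\<close>, then \<open>f\<close> is positive on \<open>B\<close> outside a ball. So the heart of the
  matter is that for some \<open>n\<close> this hull stays away from \<open>0\<close> in norm (\<open>hull_bounded_away_from_zero\<close>).
  If it did not, weak compactness would produce averages of far directions converging weakly to a
  point \<open>z\<close>. Weak limits of such averages are recession directions of \<open>C\<close>; comparison with the part
  of the approximating points that comes from \<open>C - a\<close> gives either \<open>a \<in> C\<close> or \<open>z = 0\<close>. The second case is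
  the delicate one (\<open>absolute_averages_vanish\<close> and \<open>far_combination_not_weakly_null\<close>): since
  the recession cone is pointed, averages can tend to \<open>0\<close> only if they do not rely on cancellation,
  so single directions also tend weakly to \<open>0\<close>, and \<open>0\<close> would be a weak direction at infinity of \<open>B\<close>.

  Everything rests on the Hahn-Banach theorem, which is proved first. Reflexivity enters through the
  weak sequential compactness of bounded sets. That follows by applying Hahn-Banach to the upper
  limits of a sequence on the dual space, where a dominated functional is a point evaluation, and by
  separating the points of a separable subspace with countably many functionals.
\<close>

section \<open>The Hahn-Banach theorem\<close>

text \<open>
  The Hahn-Banach theorem in a form where the dominating sublinear functional is replaced by a
  convex cone \<open>P\<close> that plays the role of its epigraph. This spares every application the check that
  some infimum is finite and sublinear. Among the convex cones containing \<open>P\<close> that contain no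
  \<open>(0, a)\<close> with \<open>a < 0\<close> there is a maximal one, by Zorn's lemma; maximality forces it to be, up to
  its boundary, the half-space above the graph of a linear functional.
\<close>

lemma Hahn_Banach_cone:
  fixes P :: "('a::real_vector \<times> real) set"
  assumes add: "\<And>u v. u \<in> P \<Longrightarrow> v \<in> P \<Longrightarrow> u + v \<in> P"
    and scale: "\<And>t u. 0 < t \<Longrightarrow> u \<in> P \<Longrightarrow> t *\<^sub>R u \<in> P"
    and total: "\<And>x. \<exists>a. (x, a) \<in> P"
    and zero: "\<And>a. (0, a) \<in> P \<Longrightarrow> 0 \<le> a"
  obtains L where "linear L" "\<And>x a. (x, a) \<in> P \<Longrightarrow> L x \<le> a"
proof -
  define good where "good Q \<longleftrightarrow> P \<subseteq> Q \<and> (\<forall>u\<in>Q. \<forall>v\<in>Q. u + v \<in> Q) \<and>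
      (\<forall>t>0. \<forall>u\<in>Q. t *\<^sub>R u \<in> Q) \<and> (\<forall>a. (0, a) \<in> Q \<longrightarrow> 0 \<le> a)" for Q :: "('a \<times> real) set"
  have "\<exists>M\<in>Collect good. \<forall>X\<in>Collect good. M \<subseteq> X \<longrightarrow> X = M"
  proof (rule subset_Zorn_nonempty)
    show "Collect good \<noteq> {}"
    proof -
      have "good P" unfolding good_def by (intro conjI ballI allI impI subset_refl add scale zero)
      then show ?thesis by auto
    qed
    fix \<C> assume ne: "\<C> \<noteq> {}" and ch: "subset.chain (Collect good) \<C>"
    have sub: "\<C> \<subseteq> Collect good" and tot: "\<And>X Y. X \<in> \<C> \<Longrightarrow> Y \<in> \<C> \<Longrightarrow> X \<subseteq> Y \<or> Y \<subseteq> X"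
      using ch unfolding subset.chain_def subset_chain_def by blast+
    have "u + v \<in> \<Union>\<C>" if "u \<in> \<Union>\<C>" "v \<in> \<Union>\<C>" for u v
    proof -
      from that obtain X Y where "X \<in> \<C>" "u \<in> X" "Y \<in> \<C>" "v \<in> Y" by blast
      then obtain Z where "Z \<in> \<C>" "u \<in> Z" "v \<in> Z" using tot[of X Y] by blast
      then show ?thesis using sub unfolding good_def by blast
    qed
    moreover have "P \<subseteq> \<Union>\<C>"
    proof -
      from ne obtain X where "X \<in> \<C>" by blast
      then have "P \<subseteq> X" using sub unfolding good_def by blast
      then show ?thesis using \<open>X \<in> \<C>\<close> by blast
    qed
    moreover have "t *\<^sub>R u \<in> \<Union>\<C>" if tu: "t > 0" "u \<in> \<Union>\<C>" for t u
    proof -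
      obtain X where X: "X \<in> \<C>" "u \<in> X" using tu by blast
      then have "t *\<^sub>R u \<in> X" using sub tu(1) unfolding good_def by blast
      then show ?thesis using X by blast
    qed
    moreover have "0 \<le> a" if a: "(0, a) \<in> \<Union>\<C>" for a
    proof -
      obtain X where X: "X \<in> \<C>" "(0, a) \<in> X" using a by blast
      then have "good X" using sub by blast
      then show ?thesis using X(2) unfolding good_def by simp
    qed
    ultimately have "good (\<Union>\<C>)" unfolding good_def by simp
    then show "\<Union>\<C> \<in> Collect good" by simp
  qed
  then obtain M where "good M" and max: "\<And>X. good X \<Longrightarrow> M \<subseteq> X \<Longrightarrow> X = M"
    by blast
  then have PM: "P \<subseteq> M" and M_add: "\<And>u v. u \<in> M \<Longrightarrow> v \<in> M \<Longrightarrow> u + v \<in> M"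
    and M_scale: "\<And>t u. 0 < t \<Longrightarrow> u \<in> M \<Longrightarrow> t *\<^sub>R u \<in> M"
    and M_zero: "\<And>a. (0, a) \<in> M \<Longrightarrow> 0 \<le> a"
    unfolding good_def by blast+
  have M_total: "\<exists>a. (x, a) \<in> M" for x
    using total[of x] PM by blast
  have M_opp: "- a \<le> b" if "(x, a) \<in> M" "(- x, b) \<in> M" for x a b
    using M_zero[of "a + b"] M_add[OF that] by simp
  \<comment> \<open>By maximality, adding the ray through \<open>(x, a)\<close> to the cone creates a negative element over \<open>0\<close>.
    Up to scaling, it is the sum of \<open>(x, a)\<close> and an element of the cone over \<open>- x\<close>.\<close>
  have dichotomy: "\<exists>b < - a. (- x, b) \<in> M" if out: "(x, a) \<notin> M" for x a
  proof (rule ccontr)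
    assume no: "\<not> ?thesis"
    define M0 where "M0 = insert 0 M"
    define N where "N = {m + t *\<^sub>R (x, a) | m t. m \<in> M0 \<and> 0 \<le> t}"
    have M0_add: "u + v \<in> M0" if "u \<in> M0" "v \<in> M0" for u v
      using that unfolding M0_def by (auto intro: M_add)
    have M0_scale: "s *\<^sub>R u \<in> M0" if "0 < s" "u \<in> M0" for s u
      using that unfolding M0_def by (auto intro: M_scale)
    have addN: "u + v \<in> N" if "u \<in> N" "v \<in> N" for u v
    proof -
      obtain m n s t where uv: "u = m + s *\<^sub>R (x, a)" "v = n + t *\<^sub>R (x, a)"
          "m \<in> M0" "n \<in> M0" "0 \<le> s" "0 \<le> t"
        using \<open>u \<in> N\<close> \<open>v \<in> N\<close> unfolding N_def by blast
      have "u + v = (m + n) + (s + t) *\<^sub>R (x, a)"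
        unfolding uv scaleR_add_left by (simp add: algebra_simps)
      then show ?thesis
        unfolding N_def using M0_add[OF uv(3,4)] add_nonneg_nonneg[OF uv(5,6)] by blast
    qed
    have scN: "s *\<^sub>R u \<in> N" if "0 < s" "u \<in> N" for s u
    proof -
      obtain m t where u: "u = m + t *\<^sub>R (x, a)" "m \<in> M0" "0 \<le> t"
        using \<open>u \<in> N\<close> unfolding N_def by blast
      have "s *\<^sub>R u = s *\<^sub>R m + (s * t) *\<^sub>R (x, a)"
        unfolding u by (simp only: scaleR_add_right scaleR_scaleR)
      then show ?thesis
        unfolding N_def using M0_scale[OF \<open>0 < s\<close> u(2)]
          mult_nonneg_nonneg[OF less_imp_le[OF \<open>0 < s\<close>] u(3)] by blast
    qed
    have ray: "0 \<le> c + t * a" if "t > 0" "(y, c) \<in> M" "y + t *\<^sub>R x = 0" for t y c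
    proof -
      have "y = - (t *\<^sub>R x)" using that(3) by (simp add: eq_neg_iff_add_eq_0)
      then have "inverse t *\<^sub>R (y, c) = (- x, c / t)" using \<open>t > 0\<close> by (simp add: field_simps)
      then have "(- x, c / t) \<in> M" using M_scale[of "inverse t" "(y, c)"] that by simp
      then have "- a \<le> c / t" using no by force
      then show ?thesis using \<open>t > 0\<close> by (simp add: field_simps)
    qed
    obtain c0 where c0: "(0, c0) \<in> M" using M_total by blast
    have "0 \<le> a" if "x = 0"
    proof (rule ccontr)
      assume "\<not> 0 \<le> a"
      define t where "t = (c0 + 1) / - a"
      have "0 < t" "c0 + t * a < 0"
        using \<open>\<not> 0 \<le> a\<close> M_zero[OF c0] by (auto simp: t_def field_simps)
      then show False using ray[of t 0 c0] c0 that by simp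
    qed
    have zeroN: "0 \<le> c" if "(0, c) \<in> N" for c
    proof -
      obtain y d t where m: "(y, d) \<in> M0" "0 \<le> t" "y + t *\<^sub>R x = 0" "c = d + t * a"
        using \<open>(0, c) \<in> N\<close> unfolding N_def by (auto simp: prod_eq_iff)
      show ?thesis
      proof (cases "t = 0")
        case True
        then show ?thesis using m M_zero by (auto simp: M0_def zero_prod_def)
      next
        case False
        show ?thesis
        proof (cases "(y, d) \<in> M")
          case True
          then show ?thesis using ray[of t y d] m False by simp
        next
          case False
          then show ?thesis using m \<open>t \<noteq> 0\<close> \<open>x = 0 \<Longrightarrow> 0 \<le> a\<close>
            by (auto simp: M0_def zero_prod_def)
        qed
      qed
    qed
    have MN: "M \<subseteq> N"
    proof
      fix m assume "m \<in> M"
      then have "m = m + 0 *\<^sub>R (x, a)" "m \<in> M0" by (simp_all add: M0_def zero_prod_def[symmetric])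
      then show "m \<in> N" unfolding N_def by blast
    qed
    have "good N"
      unfolding good_def using addN scN zeroN MN PM by blast
    then have "N = M" using max MN by blast
    moreover have "(x, a) = 0 + 1 *\<^sub>R (x, a)" "0 \<in> M0" by (simp_all add: M0_def zero_prod_def)
    then have "(x, a) \<in> N" unfolding N_def using zero_le_one by blast
    ultimately show False using out by simp
  qed
  define L where "L x = Inf {a. (x, a) \<in> M}" for x
  have bdd: "bdd_below {a. (x, a) \<in> M}" for x
  proof -
    obtain b where "(- x, b) \<in> M" using M_total by blast
    then show ?thesis using M_opp[of x] by (intro bdd_belowI[of _ "- b"]) (auto simp: minus_le_iff)
  qed
  have L_le: "L x \<le> a" if "(x, a) \<in> M" for x a
    unfolding L_def using that by (intro cInf_lower bdd) auto
  have L_ge: "c \<le> L x" if "\<And>a. (x, a) \<in> M \<Longrightarrow> c \<le> a" for x c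
    unfolding L_def using that M_total[of x] by (intro cInf_greatest) auto
  have L_near: "\<exists>a. (x, a) \<in> M \<and> a < L x + e" if "e > 0" for x e
    using L_ge[of x "L x + e"] that by force
  have L_sub: "L (x + y) \<le> L x + L y" for x y
  proof (rule field_le_epsilon)
    fix e :: real assume "e > 0"
    then obtain a b where ab: "(x, a) \<in> M" "a < L x + e / 2" "(y, b) \<in> M" "b < L y + e / 2"
      using L_near[of "e / 2" x] L_near[of "e / 2" y] by auto
    then have "L (x + y) \<le> a + b" using L_le M_add[OF ab(1,3)] by simp
    then show "L (x + y) \<le> L x + L y + e" using ab by linarith
  qed
  have L_neg: "L (- x) = - L x" for x
  proof (rule antisym)
    show "L (- x) \<le> - L x"
    proof (rule field_le_epsilon)
      fix e :: real assume "e > 0"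
      then have "(x, L x - e) \<notin> M" using L_le[of x "L x - e"] by auto
      then obtain b where "b < - (L x - e)" "(- x, b) \<in> M" using dichotomy by blast
      then show "L (- x) \<le> - L x + e" using L_le[of "- x" b] by simp
    qed
    show "- L x \<le> L (- x)"
    proof (rule L_ge)
      fix b assume "(- x, b) \<in> M"
      then have "- b \<le> L x" using M_opp by (intro L_ge) (auto simp: minus_le_iff)
      then show "- L x \<le> b" by simp
    qed
  qed
  have L_add: "L (x + y) = L x + L y" for x y
    using L_sub[of x y] L_sub[of "x + y" "- y"] L_neg[of y] by simp
  have L_scale_le: "L (t *\<^sub>R x) \<le> t * L x" if "t > 0" for t x
  proof -
    have "inverse t * L (t *\<^sub>R x) \<le> L x"
    proof (rule L_ge)
      fix a assume "(x, a) \<in> M"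
      then have "L (t *\<^sub>R x) \<le> t * a" using M_scale[OF that, of "(x, a)"] L_le by simp
      then show "inverse t * L (t *\<^sub>R x) \<le> a" using that by (simp add: field_simps)
    qed
    then show ?thesis using that by (simp add: field_simps)
  qed
  have L_pos: "L (t *\<^sub>R x) = t * L x" if "t > 0" for t x
    using L_scale_le[OF that, of x] L_scale_le[OF that, of "- x"] by (simp add: L_neg)
  have "L (t *\<^sub>R x) = t * L x" for t x
  proof (cases t "0::real" rule: linorder_cases)
    case less
    then show ?thesis using L_pos[of "- t" x] L_neg[of "t *\<^sub>R x"] by simp
  next
    case equal
    then show ?thesis using L_add[of 0 0] by simp
  next
    case greater
    then show ?thesis by (rule L_pos)
  qed
  then have "linear L" using L_add by (intro linearI) auto
  then show thesis using that L_le PM by blast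
qed

section \<open>Separation by continuous functionals\<close>

text \<open>
  A single cone gives both the bound on the norm (take \<open>t = 0\<close> in its definition) and the lower
  bound on \<open>D\<close> (take \<open>y = - d\<close> and \<open>t = 1\<close>). The cone has no negative element over \<open>0\<close> because
  \<open>norm (t *\<^sub>R d) \<ge> t * \<delta>\<close>. Applied to a singleton, it yields a norming functional.
\<close>

lemma separating_functional:
  fixes D :: "'a::real_normed_vector set"
  assumes "convex D" "D \<noteq> {}" and far: "\<And>d. d \<in> D \<Longrightarrow> \<delta> \<le> norm d"
  obtains f :: "'a \<Rightarrow>\<^sub>L real" where "norm f \<le> 1" "\<And>d. d \<in> D \<Longrightarrow> \<delta> \<le> f d"
proof -
  define P where "P = {(y, a). \<exists>t\<ge>0. \<exists>d\<in>D. norm (y + t *\<^sub>R d) - t * \<delta> \<le> a}"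
  have PI: "(y, a) \<in> P" if "0 \<le> t" "d \<in> D" "norm (y + t *\<^sub>R d) - t * \<delta> \<le> a" for y a t d
    unfolding P_def using that by blast
  obtain d0 where "d0 \<in> D" using \<open>D \<noteq> {}\<close> by blast
  have norm_P: "(y, norm y) \<in> P" for y
    using PI[of 0 d0] \<open>d0 \<in> D\<close> by simp
  obtain L where "linear L" and L: "\<And>x a. (x, a) \<in> P \<Longrightarrow> L x \<le> a"
  proof (rule Hahn_Banach_cone[of P])
    fix u v assume "u \<in> P" "v \<in> P"
    obtain y a where u: "u = (y, a)" by (cases u)
    obtain z b where v: "v = (z, b)" by (cases v)
    obtain t d where t: "0 \<le> t" "d \<in> D" "norm (y + t *\<^sub>R d) - t * \<delta> \<le> a"
      using \<open>u \<in> P\<close> unfolding u P_def by blast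
    obtain s e where s: "0 \<le> s" "e \<in> D" "norm (z + s *\<^sub>R e) - s * \<delta> \<le> b"
      using \<open>v \<in> P\<close> unfolding v P_def by blast
    obtain c where c: "c \<in> D" "(t + s) *\<^sub>R c = t *\<^sub>R d + s *\<^sub>R e"
    proof (cases "t + s = 0")
      case True
      then have "t = 0" "s = 0" using t s by auto
      then show ?thesis using that[of d] t by simp
    next
      case False
      have "(t / (t + s)) *\<^sub>R d + (s / (t + s)) *\<^sub>R e \<in> D"
        using \<open>convex D\<close> t s False by (intro convexD) (auto simp: add_divide_distrib[symmetric])
      then show ?thesis using False by (intro that) (auto simp: scaleR_add_right)
    qed
    have "y + z + (t + s) *\<^sub>R c = (y + t *\<^sub>R d) + (z + s *\<^sub>R e)"
      unfolding c(2) by (simp add: add_ac)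
    then have "norm (y + z + (t + s) *\<^sub>R c) \<le> norm (y + t *\<^sub>R d) + norm (z + s *\<^sub>R e)"
      by (simp only: norm_triangle_ineq)
    then show "u + v \<in> P"
      unfolding u v using t s c(1)
      by (auto intro!: PI[of "t + s" c] simp: distrib_right)
  next
    fix r :: real and u assume "0 < r" "u \<in> P"
    obtain y a where u: "u = (y, a)" by (cases u)
    obtain t d where t: "0 \<le> t" "d \<in> D" "norm (y + t *\<^sub>R d) - t * \<delta> \<le> a"
      using \<open>u \<in> P\<close> unfolding u P_def by blast
    have "norm (r *\<^sub>R y + (r * t) *\<^sub>R d) = r * norm (y + t *\<^sub>R d)"
      using norm_scaleR[of r "y + t *\<^sub>R d"] \<open>0 < r\<close> by (simp add: scaleR_add_right)
    moreover have "r * (norm (y + t *\<^sub>R d) - t * \<delta>) \<le> r * a"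
      using t \<open>0 < r\<close> by (intro mult_left_mono) auto
    ultimately show "r *\<^sub>R u \<in> P"
      unfolding u using t \<open>0 < r\<close> by (auto intro!: PI[of "r * t" d] simp: algebra_simps)
  next
    show "\<exists>a. (x, a) \<in> P" for x using norm_P by blast
  next
    fix a assume "(0, a) \<in> P"
    then obtain t d where t: "0 \<le> t" "d \<in> D" "norm (0 + t *\<^sub>R d) - t * \<delta> \<le> a"
      unfolding P_def by blast
    then show "0 \<le> a" using mult_left_mono[OF far[OF t(2)] t(1)] by simp
  next
    fix L assume "linear L" "\<And>x a. (x, a) \<in> P \<Longrightarrow> L x \<le> a"
    then show thesis by (rule that)
  qed
  interpret linear L by fact
  have L_le: "L x \<le> norm x" for x using L norm_P by blast
  have L_abs: "norm (L x) \<le> norm x * 1" for x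
    using L_le[of x] L_le[of "- x"] by (simp add: neg abs_le_iff)
  have bl: "bounded_linear L"
    by (rule bounded_linear_intro[of _ 1]) (use L_abs add scale in auto)
  show thesis
  proof (rule that)
    show "norm (Blinfun L) \<le> 1"
      by (rule norm_blinfun_bound) (use L_abs in \<open>auto simp: bounded_linear_Blinfun_apply[OF bl]\<close>)
    fix d assume "d \<in> D"
    then have "L (- d) \<le> - \<delta>" using PI[of 1 d "- d" "- \<delta>"] L by simp
    then show "\<delta> \<le> Blinfun L d" by (simp add: bounded_linear_Blinfun_apply[OF bl] neg)
  qed
qed

lemma norming_functional:
  fixes x :: "'a::real_normed_vector"
  obtains f :: "'a \<Rightarrow>\<^sub>L real" where "norm f \<le> 1" "f x = norm x"
proof -
  obtain f :: "'a \<Rightarrow>\<^sub>L real" where f: "norm f \<le> 1" "norm x \<le> f x"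
    using separating_functional[of "{x}" "norm x"] by auto
  have "f x \<le> norm x"
    using norm_blinfun[of f x] mult_right_mono[OF f(1) norm_ge_zero[of x]] by simp
  then show thesis using that f by force
qed

text \<open>
  A closed convex set is the intersection of the closed half-spaces containing it. This is how weak
  limits of sequences in the set are seen to stay in it.
\<close>

lemma mem_closed_convexI:
  fixes C :: "'a::real_normed_vector set"
  assumes "closed C" "convex C" "C \<noteq> {}"
    and le: "\<And>(f :: 'a \<Rightarrow>\<^sub>L real) \<alpha>. (\<And>c. c \<in> C \<Longrightarrow> \<alpha> \<le> f c) \<Longrightarrow> \<alpha> \<le> f x"
  shows "x \<in> C"
proof (rule ccontr)
  assume "x \<notin> C"
  then obtain \<delta> where "\<delta> > 0" and ball: "ball x \<delta> \<subseteq> - C"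
    using \<open>closed C\<close> openE[of "- C" x] by (auto simp: open_Compl)
  then have \<delta>: "\<delta> \<le> dist x c" if "c \<in> C" for c
    using that by (metis ComplD mem_ball not_le subsetD)
  obtain f :: "'a \<Rightarrow>\<^sub>L real" where f: "\<And>d. d \<in> (\<lambda>c. c - x) ` C \<Longrightarrow> \<delta> \<le> f d"
  proof (rule separating_functional)
    show "convex ((\<lambda>c. c - x) ` C)"
      using \<open>convex C\<close> by simp
    show "\<delta> \<le> norm d" if "d \<in> (\<lambda>c. c - x) ` C" for d
      using that \<delta> by (auto simp: dist_norm norm_minus_commute)
  qed (use \<open>C \<noteq> {}\<close> in auto)
  have "f x + \<delta> \<le> f c" if "c \<in> C" for c
    using f[of "c - x"] that by (simp add: blinfun.diff_right)
  then have "f x + \<delta> \<le> f x" by (rule le)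
  then show False using \<open>\<delta> > 0\<close> by simp
qed

text \<open>
  Together with the converse below this says that the recession cone is dual to the cone of
  functionals bounded below on the set, which reduces membership to sign conditions that pass to
  weak limits.
\<close>

lemma mem_reccI:
  fixes C :: "'a::real_normed_vector set"
  assumes "closed C" "convex C"
    and pos: "\<And>(f :: 'a \<Rightarrow>\<^sub>L real) \<alpha>. (\<And>c. c \<in> C \<Longrightarrow> \<alpha> \<le> f c) \<Longrightarrow> 0 \<le> f e"
  shows "e \<in> recc C"
  unfolding recc_def
proof (intro CollectI ballI allI impI)
  fix c and t :: real assume "c \<in> C" "0 \<le> t"
  show "c + t *\<^sub>R e \<in> C"
  proof (rule mem_closed_convexI)
    fix f :: "'a \<Rightarrow>\<^sub>L real" and \<alpha> assume *: "\<And>c. c \<in> C \<Longrightarrow> \<alpha> \<le> f c"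
    have "0 \<le> t * f e" using pos[OF *] \<open>0 \<le> t\<close> by simp
    then show "\<alpha> \<le> f (c + t *\<^sub>R e)"
      using *[OF \<open>c \<in> C\<close>] by (simp add: blinfun.add_right blinfun.scaleR_right)
  qed (use assms \<open>c \<in> C\<close> in auto)
qed

lemma recc_functional_nonneg:
  fixes C :: "'a::real_normed_vector set" and f :: "'a \<Rightarrow>\<^sub>L real"
  assumes "e \<in> recc C" "C \<noteq> {}" and le: "\<And>c. c \<in> C \<Longrightarrow> \<alpha> \<le> f c"
  shows "0 \<le> f e"
proof (rule ccontr)
  assume neg: "\<not> 0 \<le> f e"
  obtain c where "c \<in> C" using \<open>C \<noteq> {}\<close> by blast
  define t where "t = (f c - \<alpha> + 1) / - f e"
  have "t \<ge> 0" "t * f e = \<alpha> - f c - 1"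
    using neg le[OF \<open>c \<in> C\<close>] by (auto simp: t_def field_simps)
  then have "c + t *\<^sub>R e \<in> C" using \<open>e \<in> recc C\<close> \<open>c \<in> C\<close> unfolding recc_def by blast
  from le[OF this] show False
    using \<open>t * f e = _\<close> by (simp add: blinfun.add_right blinfun.scaleR_right)
qed

section \<open>Countably many functionals on a separable subspace\<close>

primrec rational_combinations :: "(nat \<Rightarrow> 'a::real_normed_vector) \<Rightarrow> nat \<Rightarrow> 'a set" where
  "rational_combinations x 0 = {0}"
| "rational_combinations x (Suc n) =
     (\<lambda>(d, q). d + of_rat q *\<^sub>R x n) ` (rational_combinations x n \<times> UNIV)"

lemma countable_rational_combinations: "countable (rational_combinations x n)"
  by (induction n) (auto intro!: countable_image countable_SIGMA)

lemma rational_combinations_dense: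
  assumes "y \<in> span (x ` {..<n})" "e > 0"
  shows "\<exists>d\<in>rational_combinations x n. dist d y < e"
  using assms
proof (induction n arbitrary: y e)
  case 0
  then show ?case by auto
next
  case (Suc n)
  have "x ` {..<Suc n} = insert (x n) (x ` {..<n})" by (auto simp: lessThan_Suc)
  then obtain k where k: "y - k *\<^sub>R x n \<in> span (x ` {..<n})"
    using Suc.prems(1) span_breakdown_eq by metis
  obtain d where d: "d \<in> rational_combinations x n" "dist d (y - k *\<^sub>R x n) < e / 2"
    using Suc.IH[OF k, of "e / 2"] Suc.prems(2) by auto
  define r where "r = e / (2 * (norm (x n) + 1))"
  have pos: "norm (x n) + 1 > 0" by (simp add: add_nonneg_pos)
  then have "r > 0" using Suc.prems(2) by (simp add: r_def)
  then obtain q where q: "k - r < of_rat q" "of_rat q < k + r"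
    using of_rat_dense[of "k - r" "k + r"] by auto
  have "\<bar>of_rat q - k\<bar> * norm (x n) \<le> r * norm (x n)"
    using q by (intro mult_right_mono) auto
  also have "\<dots> \<le> r * (norm (x n) + 1)"
    using \<open>r > 0\<close> by simp
  also have "\<dots> = e / 2"
    using pos unfolding r_def by (simp add: field_simps)
  finally have "norm ((of_rat q - k) *\<^sub>R x n) \<le> e / 2" by simp
  moreover have "dist (d + of_rat q *\<^sub>R x n) y
      = norm ((d - (y - k *\<^sub>R x n)) + (of_rat q - k) *\<^sub>R x n)"
    by (simp add: dist_norm algebra_simps)
  moreover have "norm (d - (y - k *\<^sub>R x n)) < e / 2"
    using d(2) by (simp add: dist_norm)
  ultimately have "dist (d + of_rat q *\<^sub>R x n) y < e"
    using norm_triangle_ineq[of "d - (y - k *\<^sub>R x n)" "(of_rat q - k) *\<^sub>R x n"] by linarith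
  then show ?case using d(1) by (force simp: image_iff)
qed

text \<open>
  The functionals norm the members of a countable dense set. If all of them vanish at a difference
  \<open>w\<close> of two points, each dense point \<open>d\<close> satisfies \<open>norm d \<le> norm (d - w)\<close>; when \<open>w\<close> is nonzero this
  fails for \<open>d\<close> within distance \<open>norm w / 2\<close> of \<open>w\<close>.
\<close>

lemma countable_separating_family:
  fixes x :: "nat \<Rightarrow> 'a::real_normed_vector"
  obtains F :: "nat \<Rightarrow> ('a \<Rightarrow>\<^sub>L real)" where "\<And>m. norm (F m) \<le> 1"
    "\<And>y z. y \<in> closure (span (range x)) \<Longrightarrow> z \<in> closure (span (range x)) \<Longrightarrow>
       (\<And>m. F m y = F m z) \<Longrightarrow> y = z"
proof -
  define D where "D = (\<Union>n. rational_combinations x n)"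
  have "countable D" unfolding D_def by (intro countable_UN countable_rational_combinations) auto
  have "0 \<in> D" unfolding D_def by (rule UN_I[of 0]) auto
  have "\<exists>f. \<forall>d. norm (f d) \<le> 1 \<and> blinfun_apply (f d) d = norm d"
    by (rule choice) (metis norming_functional)
  then obtain f :: "'a \<Rightarrow> 'a \<Rightarrow>\<^sub>L real" where f: "\<And>d. norm (f d) \<le> 1" "\<And>d. f d d = norm d"
    by blast
  have dense: "\<exists>d\<in>D. dist d y < e" if y: "y \<in> closure (span (range x))" and "e > 0" for y e
  proof -
    obtain z where z: "z \<in> span (range x)" "dist z y < e / 2"
      using closure_approachable[THEN iffD1, rule_format, OF y, of "e / 2"] \<open>e > 0\<close> by auto
    obtain T where T: "T \<subseteq> range x" "finite T" "z \<in> span T"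
      using z(1) by (auto simp: span_explicit)
    then obtain I where I: "finite I" "T = x ` I" by (meson finite_subset_image)
    then obtain n where "I \<subseteq> {..<n}" by (meson finite_nat_bounded)
    then have "z \<in> span (x ` {..<n})" using T(3) I(2) span_mono[of T "x ` {..<n}"] by blast
    from rational_combinations_dense[OF this, of "e / 2"]
    obtain d where "d \<in> rational_combinations x n" "dist d z < e / 2" using \<open>e > 0\<close> by auto
    then show ?thesis using z(2) dist_triangle[of d y z] unfolding D_def by force
  qed
  show thesis
  proof (rule that[of "\<lambda>m. f (from_nat_into D m)"])
    show "norm (f (from_nat_into D m)) \<le> 1" for m by (rule f)
    fix y z assume yz: "y \<in> closure (span (range x))" "z \<in> closure (span (range x))"
      and eq: "\<And>m. f (from_nat_into D m) y = f (from_nat_into D m) z"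
    obtain u v where "\<And>n. u n \<in> span (range x)" "u \<longlonglongrightarrow> y" "\<And>n. v n \<in> span (range x)" "v \<longlonglongrightarrow> z"
      using yz unfolding closure_sequential by blast
    then have "\<forall>n. u n - v n \<in> span (range x)" "(\<lambda>n. u n - v n) \<longlonglongrightarrow> y - z"
      by (auto intro: span_diff tendsto_diff)
    then have w: "y - z \<in> closure (span (range x))"
      unfolding closure_sequential by (intro exI[of _ "\<lambda>n. u n - v n"]) simp
    show "y = z"
    proof (rule ccontr)
      assume "y \<noteq> z"
      then obtain d where d: "d \<in> D" "dist d (y - z) < norm (y - z) / 2"
        using dense[OF w, of "norm (y - z) / 2"] by auto
      then obtain m where "from_nat_into D m = d"
        using from_nat_into_surj[OF \<open>countable D\<close>] by blast
      then have "f d (y - z) = 0" using eq[of m] by (simp add: blinfun.diff_right)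
      then have "norm d = f d (d - (y - z))" by (simp add: blinfun.diff_right f)
      also have "\<dots> \<le> norm (f d) * norm (d - (y - z))" using norm_blinfun[of "f d" "d - (y - z)"] by (simp add: abs_le_iff)
      also have "\<dots> \<le> norm (d - (y - z))" using f(1)[of d] by (simp add: mult_left_le_one_le)
      finally show False
        using d(2) norm_triangle_ineq2[of "y - z" d] unfolding dist_norm by (simp add: norm_minus_commute)
    qed
  qed
qed

section \<open>Weak sequential compactness in reflexive spaces\<close>

text \<open>
  The upper limit \<open>limsup f (x n)\<close> is a sublinear functional of \<open>f\<close> on the dual space. Any linear
  functional below it is bounded, hence by reflexivity the evaluation at a point \<open>z\<close>. Applied to
  \<open>f\<close> and \<open>- f\<close>, the conclusion places \<open>f z\<close> between the lower and the upper limit of \<open>f (x n)\<close>.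
\<close>

lemma weak_cluster_point:
  fixes x :: "nat \<Rightarrow> 'a::banach"
  assumes refl: "reflexive_space TYPE('a)" and bound: "\<And>n. norm (x n) \<le> M"
  obtains z where "\<And>(f :: 'a \<Rightarrow>\<^sub>L real) c. eventually (\<lambda>n. f (x n) \<le> c) sequentially \<Longrightarrow> f z \<le> c"
proof -
  have fx: "\<bar>f (x n)\<bar> \<le> norm f * M" for f :: "'a \<Rightarrow>\<^sub>L real" and n
    using norm_blinfun[of f "x n"] mult_left_mono[OF bound[of n] norm_ge_zero[of f]] by simp
  define P where "P = {(f :: 'a \<Rightarrow>\<^sub>L real, c). eventually (\<lambda>n. f (x n) \<le> c) sequentially}"
  have norm_P: "(f, norm f * M) \<in> P" for f
    using fx[of f] by (auto simp: P_def abs_le_iff)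
  obtain L where "linear L" and L: "\<And>f c. (f, c) \<in> P \<Longrightarrow> L f \<le> c"
  proof (rule Hahn_Banach_cone[of P])
    fix u v assume "u \<in> P" "v \<in> P"
    moreover obtain f a where u: "u = (f, a)" by (cases u)
    moreover obtain g b where v: "v = (g, b)" by (cases v)
    ultimately have "eventually (\<lambda>n. f (x n) \<le> a) sequentially" "eventually (\<lambda>n. g (x n) \<le> b) sequentially"
      unfolding P_def by auto
    then have "eventually (\<lambda>n. (f + g) (x n) \<le> a + b) sequentially"
      by eventually_elim (simp add: blinfun.add_left)
    then show "u + v \<in> P" unfolding P_def u v by simp
  next
    fix t :: real and u assume "0 < t" "u \<in> P"
    then show "t *\<^sub>R u \<in> P"
      unfolding P_def by (auto simp: blinfun.scaleR_left)
  next
    show "\<exists>c. (f, c) \<in> P" for f using norm_P by blast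
  next
    show "0 \<le> c" if "(0, c) \<in> P" for c using that by (simp add: P_def)
  next
    fix L assume "linear L" "\<And>f c. (f, c) \<in> P \<Longrightarrow> L f \<le> c"
    then show thesis by (rule that)
  qed
  interpret linear L by fact
  have "norm (L f) \<le> norm f * M" for f
    using L[OF norm_P[of f]] L[OF norm_P[of "- f"]] by (simp add: neg abs_le_iff)
  then have bl: "bounded_linear L"
    by (intro bounded_linear_intro[of _ M]) (auto simp: add scale)
  obtain z where "Blinfun L = bidual_embedding z"
    using refl unfolding reflexive_space_def by (metis surjD)
  then have "L f = f z" for f
    by (metis bidual_embedding.rep_eq bounded_linear_Blinfun_apply[OF bl])
  then show thesis using that[of z] L by (simp add: P_def)
qed

text \<open>
  A diagonal argument makes a countable family of functionals, separating the points of the closed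
  span \<open>Y\<close> of the sequence, converge along a subsequence. All cluster points of its subsequences then
  coincide, since they lie in \<open>Y\<close> and agree on that family; so the subsequence converges weakly.
\<close>

lemma bounded_imp_weakly_convergent_subsequence:
  fixes x :: "nat \<Rightarrow> 'a::banach"
  assumes refl: "reflexive_space TYPE('a)" and bound: "\<And>n. norm (x n) \<le> M"
  obtains r z where "strict_mono r" "\<And>f :: 'a \<Rightarrow>\<^sub>L real. (\<lambda>n. f (x (r n))) \<longlonglongrightarrow> f z"
proof -
  define Y where "Y = closure (span (range x))"
  obtain F :: "nat \<Rightarrow> ('a \<Rightarrow>\<^sub>L real)" where F1: "\<And>m. norm (F m) \<le> 1"
    and sep: "\<And>y z. y \<in> Y \<Longrightarrow> z \<in> Y \<Longrightarrow> (\<And>m. F m y = F m z) \<Longrightarrow> y = z"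
    unfolding Y_def using countable_separating_family[of x] by metis
  have bnd: "norm (F m (x n)) \<le> M" for m n
    using norm_blinfun[of "F m" "x n"] mult_mono[OF F1[of m] bound[of n]] by simp
  obtain r where r: "strict_mono (r :: nat \<Rightarrow> nat)"
    and conv: "\<And>m. \<exists>l. (\<lambda>n. F m (x (r n))) \<longlonglongrightarrow> l"
    by (rule function_convergent_subsequence[of UNIV "\<lambda>n m. F m (x n)" M]) (use bnd in auto)
  then obtain l where l: "\<And>m. (\<lambda>n. F m (x (r n))) \<longlonglongrightarrow> l m" by metis
  have unique: "z \<in> Y \<and> (\<forall>m. F m z = l m)"
    if s: "strict_mono s" and z: "\<And>(f :: 'a \<Rightarrow>\<^sub>L real) c.
      eventually (\<lambda>n. f (x (r (s n))) \<le> c) sequentially \<Longrightarrow> f z \<le> c" for s z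
  proof
    have z_ge: "c \<le> f z" if "eventually (\<lambda>n. c \<le> f (x (r (s n)))) sequentially"
      for f :: "'a \<Rightarrow>\<^sub>L real" and c
      using z[of "- f" "- c"] that by (simp add: blinfun.minus_left)
    show "z \<in> Y"
    proof (rule mem_closed_convexI)
      show "convex Y" "closed Y" "Y \<noteq> {}"
        unfolding Y_def using span_zero[of "range x"] by (auto simp: subspace_imp_convex)
      have in_Y: "x n \<in> Y" for n
        unfolding Y_def by (meson closure_subset rangeI span_base subsetD)
      fix f :: "'a \<Rightarrow>\<^sub>L real" and \<alpha> assume "\<And>c. c \<in> Y \<Longrightarrow> \<alpha> \<le> f c"
      then show "\<alpha> \<le> f z" using in_Y by (intro z_ge) auto
    qed
    show "\<forall>m. F m z = l m"
    proof
      fix m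
      have lim: "(\<lambda>n. F m (x (r (s n)))) \<longlonglongrightarrow> l m"
        using LIMSEQ_subseq_LIMSEQ[OF l s] by (simp add: o_def)
      show "F m z = l m"
      proof (rule antisym; rule field_le_epsilon)
        fix e :: real assume "e > 0"
        show "F m z \<le> l m + e"
          by (rule z, rule eventually_mono[OF order_tendstoD(2)[OF lim, of "l m + e"]]) (use \<open>e > 0\<close> in auto)
        have "l m - e \<le> F m z"
          by (rule z_ge, rule eventually_mono[OF order_tendstoD(1)[OF lim, of "l m - e"]]) (use \<open>e > 0\<close> in auto)
        then show "l m \<le> F m z + e" by simp
      qed
    qed
  qed
  obtain z where z: "\<And>(f :: 'a \<Rightarrow>\<^sub>L real) c.
      eventually (\<lambda>n. f (x (r n)) \<le> c) sequentially \<Longrightarrow> f z \<le> c"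
    using weak_cluster_point[OF refl, of "\<lambda>n. x (r n)"] bound by blast
  have upper: "eventually (\<lambda>n. f (x (r n)) < f z + e) sequentially"
    if "e > 0" for f :: "'a \<Rightarrow>\<^sub>L real" and e
  proof (rule ccontr)
    assume "\<not> ?thesis"
    from not_eventually_sequentiallyD[OF this]
    obtain s where s: "strict_mono (s :: nat \<Rightarrow> nat)" "\<And>n. f z + e \<le> f (x (r (s n)))"
      by (auto simp: not_less)
    obtain w where w: "\<And>(f :: 'a \<Rightarrow>\<^sub>L real) c.
        eventually (\<lambda>n. f (x (r (s n))) \<le> c) sequentially \<Longrightarrow> f w \<le> c"
      using weak_cluster_point[OF refl, of "\<lambda>n. x (r (s n))"] bound by blast
    have "w = z"
      using sep[of w z] unique[OF s(1) w] unique[of id z] z by (simp add: strict_mono_def)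
    moreover have "(- f) w \<le> - (f z + e)"
      by (intro w always_eventually allI) (use s(2) in \<open>simp only: blinfun.minus_left neg_le_iff_le\<close>)
    ultimately show False using \<open>e > 0\<close> by (simp add: blinfun.minus_left)
  qed
  have "(\<lambda>n. f (x (r n))) \<longlonglongrightarrow> f z" for f :: "'a \<Rightarrow>\<^sub>L real"
  proof (rule order_tendstoI)
    fix a assume "f z < a"
    then show "eventually (\<lambda>n. f (x (r n)) < a) sequentially" using upper[of "a - f z" f] by simp
  next
    fix a assume "a < f z"
    then show "eventually (\<lambda>n. a < f (x (r n))) sequentially"
      using upper[of "f z - a" "- f"] by (simp add: blinfun.minus_left)
  qed
  then show thesis using that r by blast
qed

text \<open>
  The asymptotic cone is defined with decreasing factors, while \<open>1 / norm (b n)\<close> merely tends to \<open>0\<close>;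
  a further monotone subsequence repairs this.
\<close>

lemma weak_direction_subsequence:
  fixes b :: "nat \<Rightarrow> 'a::banach"
  assumes refl: "reflexive_space TYPE('a)"
    and "range b \<subseteq> B" and inf: "filterlim (\<lambda>n. norm (b n)) at_top sequentially"
  obtains r \<xi> where "strict_mono (r :: nat \<Rightarrow> nat)" "\<xi> \<in> weak_directions_at_infinity B" "\<xi> \<in> weak_asymptotic_cone B"
    "\<And>f :: 'a \<Rightarrow>\<^sub>L real. (\<lambda>n. f (b (r n) /\<^sub>R norm (b (r n)))) \<longlonglongrightarrow> f \<xi>"
proof -
  obtain r \<xi> where r: "strict_mono (r :: nat \<Rightarrow> nat)"
    and lim: "\<And>f :: 'a \<Rightarrow>\<^sub>L real. (\<lambda>n. f (b (r n) /\<^sub>R norm (b (r n)))) \<longlonglongrightarrow> f \<xi>"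
    by (rule bounded_imp_weakly_convergent_subsequence[OF refl, of "\<lambda>n. b n /\<^sub>R norm (b n)" 1])
      (auto simp: divide_simps)
  have inf_r: "filterlim (\<lambda>n. norm (b (r n))) at_top sequentially"
    using filterlim_compose[OF inf filterlim_subseq[OF r]] by simp
  have "\<xi> \<in> weak_directions_at_infinity B"
    unfolding weak_directions_at_infinity_def limitin_weak_topology_iff
    using inf_r lim \<open>range b \<subseteq> B\<close> by (intro CollectI exI[of _ "\<lambda>n. b (r n)"]) auto
  moreover have "\<xi> \<in> weak_asymptotic_cone B"
  proof -
    define t where "t n = inverse (norm (b (r n)))" for n
    have t_lim: "t \<longlonglongrightarrow> 0"
      unfolding t_def by (rule tendsto_inverse_0_at_top[OF inf_r])
    obtain s where s: "strict_mono (s :: nat \<Rightarrow> nat)" "monoseq (\<lambda>n. t (s n))"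
      using seq_monosub by blast
    have ts_lim: "(\<lambda>n. t (s n)) \<longlonglongrightarrow> 0"
      using LIMSEQ_subseq_LIMSEQ[OF t_lim s(1)] by (simp add: o_def)
    have "decseq (\<lambda>n. t (s n))"
    proof (cases "incseq (\<lambda>n. t (s n))")
      \<comment> \<open>An increasing sequence of nonnegative numbers with limit \<open>0\<close> is constantly \<open>0\<close>.\<close>
      case True
      then have "t (s n) = 0" for n
        using incseq_le[OF True ts_lim, of n] by (simp add: t_def)
      then show ?thesis by (simp add: decseq_def)
    next
      case False
      then show ?thesis using s(2) by (simp add: monoseq_iff)
    qed
    moreover have "(\<lambda>n. f (t (s n) *\<^sub>R b (r (s n)))) \<longlonglongrightarrow> f \<xi>" for f :: "'a \<Rightarrow>\<^sub>L real"
      using LIMSEQ_subseq_LIMSEQ[OF lim[of f] s(1)] by (simp add: o_def t_def)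
    ultimately show ?thesis
      unfolding weak_asymptotic_cone_def limitin_weak_topology_iff
      using ts_lim \<open>range b \<subseteq> B\<close>
      by (intro CollectI exI[of _ "\<lambda>n. b (r (s n))"] exI[of _ "\<lambda>n. t (s n)"]) auto
  qed
  ultimately show thesis using that r lim by blast
qed

section \<open>Convex combinations of far directions\<close>

definition far_directions :: "'a::real_normed_vector set \<Rightarrow> nat \<Rightarrow> 'a set" where
  "far_directions B n = {b /\<^sub>R norm b | b. b \<in> B \<and> real n \<le> norm b}"

lemma far_directions_antimono: "m \<le> n \<Longrightarrow> far_directions B n \<subseteq> far_directions B m"
  unfolding far_directions_def by force

lemma norm_far_directions: "v \<in> far_directions B n \<Longrightarrow> norm v \<le> 1"
  by (auto simp: far_directions_def divide_simps)

text \<open>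
  The \<open>n\<close>-th set \<open>S n\<close> carries a measure of mass at most \<open>1\<close> with weights \<open>w n\<close>, supported on directions
  of points of \<open>B\<close> of norm at least \<open>n\<close>. Weights rather than points of a convex hull are needed because
  \<open>absolute_averages_vanish\<close> below splits these measures.
\<close>

definition far_weights :: "'a::real_normed_vector set \<Rightarrow> (nat \<Rightarrow> 'a set) \<Rightarrow> (nat \<Rightarrow> 'a \<Rightarrow> real) \<Rightarrow> bool" where
  "far_weights B S w \<longleftrightarrow> (\<forall>n. finite (S n) \<and> S n \<subseteq> far_directions B n \<and>
     (\<forall>v\<in>S n. 0 \<le> w n v) \<and> sum (w n) (S n) \<le> 1)"

lemma far_weights_subseq:
  assumes "far_weights B S w" "strict_mono r" "\<And>n. T n \<subseteq> S (r n)"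
  shows "far_weights B T (\<lambda>n. w (r n))"
  unfolding far_weights_def
proof (intro allI conjI)
  fix n
  have S: "finite (S (r n))" "S (r n) \<subseteq> far_directions B (r n)" "\<forall>v\<in>S (r n). 0 \<le> w (r n) v"
    "sum (w (r n)) (S (r n)) \<le> 1"
    using assms(1) unfolding far_weights_def by blast+
  show "finite (T n)" using S(1) assms(3) finite_subset by blast
  show "T n \<subseteq> far_directions B n"
    using S(2) assms(3)[of n] far_directions_antimono[OF seq_suble[OF assms(2), of n], of B] by blast
  show "\<forall>v\<in>T n. 0 \<le> w (r n) v" using S(3) assms(3) by blast
  have "sum (w (r n)) (T n) \<le> sum (w (r n)) (S (r n))"
    using S(1,3) assms(3)[of n] by (intro sum_mono2) auto
  then show "sum (w (r n)) (T n) \<le> 1" using S(4) by simp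
qed

lemma norm_far_combination:
  assumes "far_weights B S w"
  shows "norm (\<Sum>v\<in>S n. w n v *\<^sub>R v) \<le> 1"
proof -
  have "norm (\<Sum>v\<in>S n. w n v *\<^sub>R v) \<le> (\<Sum>v\<in>S n. w n v)"
  proof (rule sum_norm_le)
    fix v assume "v \<in> S n"
    then have "norm v \<le> 1" "0 \<le> w n v"
      using assms norm_far_directions unfolding far_weights_def by blast+
    then show "norm (w n v *\<^sub>R v) \<le> w n v"
      using mult_left_mono[of "norm v" 1 "w n v"] by simp
  qed
  also have "\<dots> \<le> 1" using assms unfolding far_weights_def by blast
  finally show ?thesis .
qed

text \<open>
  Only the part in the convex set \<open>D\<close> is collapsed to one point; the weights on \<open>U\<close> are kept.
\<close>

lemma convex_hull_Un_explicit:
  fixes D U :: "'a::real_vector set"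
  assumes "convex D" "D \<noteq> {}" "x \<in> convex hull (D \<union> U)"
  obtains l d S w where "0 \<le> l" "d \<in> D" "finite S" "S \<subseteq> U" "\<And>v. v \<in> S \<Longrightarrow> 0 \<le> w v"
    "l + sum w S = 1" "x = l *\<^sub>R d + (\<Sum>v\<in>S. w v *\<^sub>R v)"
proof -
  obtain T w where T: "finite T" "T \<subseteq> D \<union> U" "\<And>v. v \<in> T \<Longrightarrow> 0 \<le> w v" "sum w T = 1"
      "(\<Sum>v\<in>T. w v *\<^sub>R v) = x"
    using assms(3) unfolding convex_hull_explicit by blast
  define l where "l = sum w (T \<inter> D)"
  have l0: "0 \<le> l" unfolding l_def using T(3) by (intro sum_nonneg) auto
  have split: "sum g T = sum g (T \<inter> D) + sum g (T - D)" for g :: "'a \<Rightarrow> 'b::comm_monoid_add"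
    using sum.Int_Diff[OF T(1)] .
  have "\<exists>d\<in>D. (\<Sum>v\<in>T \<inter> D. w v *\<^sub>R v) = l *\<^sub>R d"
  proof (cases "l = 0")
    case True
    then have "\<forall>v\<in>T \<inter> D. w v = 0"
      unfolding l_def using T(1,3) by (subst (asm) sum_nonneg_eq_0_iff) auto
    then show ?thesis using True \<open>D \<noteq> {}\<close> by auto
  next
    case False
    have "(\<Sum>v\<in>T \<inter> D. (w v / l) *\<^sub>R v) \<in> D"
    proof (rule convex_sum)
      show "(\<Sum>v\<in>T \<inter> D. w v / l) = 1"
        using False by (simp add: sum_divide_distrib[symmetric] l_def[symmetric])
    qed (use T l0 assms(1) in auto)
    moreover have "(\<Sum>v\<in>T \<inter> D. w v *\<^sub>R v) = l *\<^sub>R (\<Sum>v\<in>T \<inter> D. (w v / l) *\<^sub>R v)"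
      using False by (simp add: scaleR_sum_right)
    ultimately show ?thesis by blast
  qed
  then obtain d where "d \<in> D" "(\<Sum>v\<in>T \<inter> D. w v *\<^sub>R v) = l *\<^sub>R d" by blast
  then show thesis
    using T l0 split[of w] split[of "\<lambda>v. w v *\<^sub>R v"]
    by (intro that[of l d "T - D" w]) (auto simp: l_def)
qed

locale pointed_recession =
  fixes B C :: "'a::banach set"
  assumes refl: "reflexive_space TYPE('a)"
    and closed: "closed C" and convex: "convex C" and nonempty: "C \<noteq> {}"
    and zero_no_direction: "0 \<notin> weak_directions_at_infinity B"
    and asymptotic: "weak_asymptotic_cone B \<subseteq> recc C"
    and pointed: "pointed_cone (recc C)"
begin

lemma opposite_recession_zero: "z \<in> recc C \<Longrightarrow> - z \<in> recc C \<Longrightarrow> z = 0"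
  using pointed unfolding pointed_cone_def by (force simp: image_iff)

lemma far_sequence_converges:
  assumes v: "\<And>k. v k \<in> far_directions B k"
  obtains r \<xi> where "strict_mono (r :: nat \<Rightarrow> nat)" "\<xi> \<in> weak_directions_at_infinity B" "\<xi> \<in> recc C"
    "\<And>f :: 'a \<Rightarrow>\<^sub>L real. (\<lambda>n. f (v (r n))) \<longlonglongrightarrow> f \<xi>"
proof -
  have "\<exists>b. \<forall>k. b k \<in> B \<and> real k \<le> norm (b k) \<and> v k = b k /\<^sub>R norm (b k)"
    using v by (intro choice) (auto simp: far_directions_def)
  then obtain b where b: "\<And>k. b k \<in> B" "\<And>k. real k \<le> norm (b k)" "\<And>k. v k = b k /\<^sub>R norm (b k)"
    by blast
  have "filterlim (\<lambda>k. norm (b k)) at_top sequentially"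
    by (rule filterlim_at_top_mono[OF filterlim_real_sequentially]) (use b in auto)
  from weak_direction_subsequence[OF refl _ this, of B]
  obtain r \<xi> where "strict_mono (r :: nat \<Rightarrow> nat)" "\<xi> \<in> weak_directions_at_infinity B"
    "\<xi> \<in> weak_asymptotic_cone B"
    "\<And>f :: 'a \<Rightarrow>\<^sub>L real. (\<lambda>n. f (b (r n) /\<^sub>R norm (b (r n)))) \<longlonglongrightarrow> f \<xi>"
    using b(1) by blast
  then show thesis using that asymptotic by (auto simp: b(3))
qed

text \<open>
  Otherwise some sequence of far directions would have a weak limit \<open>\<xi>\<close> with \<open>f \<xi> < 0\<close>. That limit is
  a recession direction of \<open>C\<close>, where \<open>f\<close> is nonnegative.
\<close>

lemma far_directions_almost_nonneg:
  fixes f :: "'a \<Rightarrow>\<^sub>L real"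
  assumes le: "\<And>c. c \<in> C \<Longrightarrow> \<alpha> \<le> f c" and "e > 0"
  obtains N where "\<And>v. v \<in> far_directions B N \<Longrightarrow> - e \<le> f v"
proof (rule ccontr)
  assume "\<not> thesis"
  then have "\<forall>k. \<exists>v. v \<in> far_directions B k \<and> f v < - e"
    using that by (meson not_le)
  then obtain v where v: "\<And>k. v k \<in> far_directions B k" "\<And>k. f (v k) < - e" by metis
  from far_sequence_converges[OF v(1)]
  obtain r \<xi> where \<xi>: "\<xi> \<in> recc C" and lim: "\<And>f :: 'a \<Rightarrow>\<^sub>L real. (\<lambda>n. f (v (r n))) \<longlonglongrightarrow> f \<xi>"
    by metis
  have "f \<xi> \<le> - e"
    by (rule tendsto_upperbound[OF lim]) (use v(2) in \<open>auto intro!: always_eventually less_imp_le\<close>)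
  then show False using recc_functional_nonneg[OF \<xi> nonempty le] \<open>e > 0\<close> by simp
qed

text \<open>
  The single directions only approach the recession cone weakly, yet the estimate
  \<open>far_directions_almost_nonneg\<close> is uniform in the direction and so survives averaging.
\<close>

lemma far_combination_limit_in_recc:
  assumes S: "far_weights B S w"
    and lim: "\<And>f :: 'a \<Rightarrow>\<^sub>L real. (\<lambda>n. f (\<Sum>v\<in>S n. w n v *\<^sub>R v)) \<longlonglongrightarrow> f g"
  shows "g \<in> recc C"
proof (rule mem_reccI[OF closed convex])
  fix f :: "'a \<Rightarrow>\<^sub>L real" and \<alpha> assume le: "\<And>c. c \<in> C \<Longrightarrow> \<alpha> \<le> f c"
  show "0 \<le> f g"
  proof (rule field_le_epsilon)
    fix e :: real assume "e > 0"
    then obtain N where N: "\<And>v. v \<in> far_directions B N \<Longrightarrow> - e \<le> f v"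
      using far_directions_almost_nonneg[OF le] by blast
    have "- e \<le> f (\<Sum>v\<in>S n. w n v *\<^sub>R v)" if "n \<ge> N" for n
    proof -
      have "- e * 1 \<le> - e * sum (w n) (S n)"
        using S \<open>e > 0\<close> unfolding far_weights_def by (intro mult_left_mono_neg) auto
      also have "\<dots> = (\<Sum>v\<in>S n. w n v * - e)"
        unfolding sum_distrib_left by (simp add: mult.commute)
      also have "\<dots> \<le> (\<Sum>v\<in>S n. w n v * f v)"
      proof (intro sum_mono mult_left_mono)
        fix v assume "v \<in> S n"
        then show "0 \<le> w n v" "- e \<le> f v"
          using S N far_directions_antimono[OF that, of B] unfolding far_weights_def by blast+
      qed
      finally show ?thesis by (simp add: blinfun.sum_right blinfun.scaleR_right)
    qed
    then have "- e \<le> f g" by (intro LIMSEQ_le_const[OF lim]) blast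
    then show "0 \<le> f g + e" by simp
  qed
qed

text \<open>
  If averages of far directions tend weakly to \<open>0\<close>, so do the averages over the part where \<open>f \<ge> 0\<close> and
  over the part where \<open>f < 0\<close>: along a subsequence these converge to opposite recession directions of
  \<open>C\<close>, which vanish because the recession cone is pointed. This replaces the theorem of Milman that
  the extreme point \<open>0\<close> of the closed convex hull of a weakly compact set belongs to that set.
\<close>

lemma absolute_averages_vanish:
  fixes f :: "'a \<Rightarrow>\<^sub>L real"
  assumes S: "far_weights B S w"
    and lim: "\<And>f :: 'a \<Rightarrow>\<^sub>L real. (\<lambda>n. f (\<Sum>v\<in>S n. w n v *\<^sub>R v)) \<longlonglongrightarrow> 0"
  shows "(\<lambda>n. \<Sum>v\<in>S n. w n v * \<bar>f v\<bar>) \<longlonglongrightarrow> 0"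
proof (rule order_tendstoI)
  fix a :: real assume "a < 0"
  have "0 \<le> (\<Sum>v\<in>S n. w n v * \<bar>f v\<bar>)" for n
    using S unfolding far_weights_def by (intro sum_nonneg) auto
  then show "eventually (\<lambda>n. a < (\<Sum>v\<in>S n. w n v * \<bar>f v\<bar>)) sequentially"
    using \<open>a < 0\<close> by (intro always_eventually allI) (rule less_le_trans)
next
  fix e :: real assume "0 < e"
  show "eventually (\<lambda>n. (\<Sum>v\<in>S n. w n v * \<bar>f v\<bar>) < e) sequentially"
  proof (rule ccontr)
    assume "\<not> ?thesis"
    from not_eventually_sequentiallyD[OF this]
    obtain r where r: "strict_mono (r :: nat \<Rightarrow> nat)"
      and large: "\<And>n. e \<le> (\<Sum>v\<in>S (r n). w (r n) v * \<bar>f v\<bar>)"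
      by (auto simp: not_less)
    define P where "P n = {v \<in> S (r n). 0 \<le> f v}" for n
    define N where "N n = {v \<in> S (r n). f v < 0}" for n
    define p where "p n = (\<Sum>v\<in>P n. w (r n) v *\<^sub>R v)" for n
    define m where "m n = (\<Sum>v\<in>N n. w (r n) v *\<^sub>R v)" for n
    have P: "far_weights B P (\<lambda>n. w (r n))" and N: "far_weights B N (\<lambda>n. w (r n))"
      by (rule far_weights_subseq[OF S r]; force simp: P_def N_def)+
    have split: "sum h (S (r n)) = sum h (P n) + sum h (N n)" for h :: "'a \<Rightarrow> 'b::comm_monoid_add" and n
    proof -
      have "S (r n) = P n \<union> N n" "P n \<inter> N n = {}" unfolding P_def N_def by auto
      moreover have "finite (P n)" "finite (N n)" using P N unfolding far_weights_def by blast+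
      ultimately show ?thesis by (simp add: sum.union_disjoint)
    qed
    have "norm (p n) \<le> 1" for n using norm_far_combination[OF P] unfolding p_def .
    then obtain s z where s: "strict_mono (s :: nat \<Rightarrow> nat)"
      and z: "\<And>f :: 'a \<Rightarrow>\<^sub>L real. (\<lambda>n. f (p (s n))) \<longlonglongrightarrow> f z"
      using bounded_imp_weakly_convergent_subsequence[OF refl, of p 1] by blast
    have mz: "(\<lambda>n. f (m (s n))) \<longlonglongrightarrow> f (- z)" for f :: "'a \<Rightarrow>\<^sub>L real"
    proof -
      have "(\<lambda>n. f (\<Sum>v\<in>S (r (s n)). w (r (s n)) v *\<^sub>R v)) \<longlonglongrightarrow> 0"
        using LIMSEQ_subseq_LIMSEQ[OF lim strict_mono_o[OF r s]] by (simp add: o_def)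
      from tendsto_diff[OF this z[of f]] show ?thesis
        by (simp add: split p_def[symmetric] m_def[symmetric] blinfun.add_right blinfun.minus_right)
    qed
    have "z \<in> recc C"
      by (rule far_combination_limit_in_recc[OF far_weights_subseq[OF P s order_refl]])
        (use z in \<open>simp add: p_def\<close>)
    moreover have "- z \<in> recc C"
      by (rule far_combination_limit_in_recc[OF far_weights_subseq[OF N s order_refl]])
        (use mz in \<open>simp add: m_def\<close>)
    ultimately have "z = 0" by (rule opposite_recession_zero)
    then have "(\<lambda>n. f (p (s n)) - f (m (s n))) \<longlonglongrightarrow> 0"
      using tendsto_diff[OF z[of f] mz[of f]] by (simp add: blinfun.minus_right)
    moreover have "f (p n) - f (m n) = (\<Sum>v\<in>S (r n). w (r n) v * \<bar>f v\<bar>)" for n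
    proof -
      have "(\<Sum>v\<in>P n. w (r n) v * \<bar>f v\<bar>) = f (p n)"
        unfolding p_def blinfun.sum_right by (intro sum.cong) (auto simp: P_def blinfun.scaleR_right)
      moreover have "(\<Sum>v\<in>N n. w (r n) v * \<bar>f v\<bar>) = - f (m n)"
        unfolding m_def blinfun.sum_right sum_negf[symmetric]
        by (intro sum.cong) (auto simp: N_def blinfun.scaleR_right)
      ultimately show ?thesis by (simp add: split)
    qed
    ultimately have "(\<lambda>n. \<Sum>v\<in>S (r (s n)). w (r (s n)) v * \<bar>f v\<bar>) \<longlonglongrightarrow> 0" by simp
    then have "e \<le> 0" by (rule tendsto_lowerbound) (use large in auto)
    then show False using \<open>0 < e\<close> by simp
  qed
qed

text \<open>
  Averages that tend weakly to \<open>0\<close> with mass tending to \<open>1\<close> would give \<open>0\<close> as a weak limit of single far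
  directions. Indeed only countably many directions occur, so a countable family \<open>F\<close> of functionals
  suffices to identify weak limits. For each \<open>k\<close>, the average of \<open>\<Sum>m\<le>k. \<bar>F m v\<bar>\<close> over a late support is
  small by \<open>absolute_averages_vanish\<close>, so this sum is small at some direction \<open>v\<close> of that support.
\<close>

lemma far_combination_not_weakly_null:
  assumes S: "far_weights B S w"
    and lim: "\<And>f :: 'a \<Rightarrow>\<^sub>L real. (\<lambda>n. f (\<Sum>v\<in>S n. w n v *\<^sub>R v)) \<longlonglongrightarrow> 0"
    and mass: "(\<lambda>n. sum (w n) (S n)) \<longlonglongrightarrow> 1"
  shows False
proof -
  define U where "U = insert 0 (\<Union>n. S n)"
  have "countable U" "U \<noteq> {}"
    using S by (auto simp: U_def far_weights_def intro: countable_finite)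
  then have range_U: "range (from_nat_into U) = U" by simp
  define Y where "Y = closure (span U)"
  obtain F :: "nat \<Rightarrow> ('a \<Rightarrow>\<^sub>L real)" where
    sep: "\<And>y z. y \<in> Y \<Longrightarrow> z \<in> Y \<Longrightarrow> (\<And>m. F m y = F m z) \<Longrightarrow> y = z"
    using countable_separating_family[of "from_nat_into U"] unfolding range_U Y_def by metis
  have "\<exists>v. v \<in> far_directions B k \<and> v \<in> U \<and> (\<Sum>m\<le>k. \<bar>F m v\<bar>) < 1 / real (Suc k)" for k
  proof -
    have "(\<lambda>n. \<Sum>m\<le>k. \<Sum>v\<in>S n. w n v * \<bar>F m v\<bar>) \<longlonglongrightarrow> (\<Sum>m\<le>k. 0)"
      by (intro tendsto_sum absolute_averages_vanish[OF S lim])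
    then have "eventually (\<lambda>n. (\<Sum>m\<le>k. \<Sum>v\<in>S n. w n v * \<bar>F m v\<bar>) < 1 / (2 * real (Suc k))) sequentially"
      by (intro order_tendstoD(2)) auto
    moreover have "eventually (\<lambda>n. 1 / 2 < sum (w n) (S n)) sequentially"
      using order_tendstoD(1)[OF mass, of "1 / 2"] by simp
    ultimately have "eventually (\<lambda>n. k \<le> n \<and> (\<Sum>m\<le>k. \<Sum>v\<in>S n. w n v * \<bar>F m v\<bar>) < 1 / (2 * real (Suc k))
        \<and> 1 / 2 < sum (w n) (S n)) sequentially"
      using eventually_ge_at_top[of k] by eventually_elim simp
    then obtain n where n: "k \<le> n" "(\<Sum>m\<le>k. \<Sum>v\<in>S n. w n v * \<bar>F m v\<bar>) < 1 / (2 * real (Suc k))"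
        "1 / 2 < sum (w n) (S n)"
      using eventually_happens'[OF sequentially_bot] by blast
    have "\<exists>v\<in>S n. (\<Sum>m\<le>k. \<bar>F m v\<bar>) < 1 / real (Suc k)"
    proof (rule ccontr)
      assume "\<not> ?thesis"
      then have ge: "1 / real (Suc k) \<le> (\<Sum>m\<le>k. \<bar>F m v\<bar>)" if "v \<in> S n" for v using that by force
      have "1 / (2 * real (Suc k)) = 1 / 2 * (1 / real (Suc k))" by simp
      also have "\<dots> \<le> sum (w n) (S n) * (1 / real (Suc k))"
        using n(3) by (intro mult_right_mono) auto
      also have "\<dots> = (\<Sum>v\<in>S n. w n v * (1 / real (Suc k)))"
        by (rule sum_distrib_right)
      also have "\<dots> \<le> (\<Sum>v\<in>S n. w n v * (\<Sum>m\<le>k. \<bar>F m v\<bar>))"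
        using S ge unfolding far_weights_def by (intro sum_mono mult_left_mono) auto
      also have "\<dots> = (\<Sum>m\<le>k. \<Sum>v\<in>S n. w n v * \<bar>F m v\<bar>)"
        unfolding sum_distrib_left by (rule sum.swap)
      finally show False using n(2) by simp
    qed
    then obtain v where "v \<in> S n" "(\<Sum>m\<le>k. \<bar>F m v\<bar>) < 1 / real (Suc k)" by blast
    moreover have "v \<in> far_directions B k"
      using S \<open>v \<in> S n\<close> far_directions_antimono[OF n(1), of B] unfolding far_weights_def by blast
    ultimately show ?thesis unfolding U_def by blast
  qed
  then obtain v where v: "\<And>k. v k \<in> far_directions B k" "\<And>k. v k \<in> U"
      "\<And>k. (\<Sum>m\<le>k. \<bar>F m (v k)\<bar>) < 1 / real (Suc k)"
    by metis
  from far_sequence_converges[OF v(1)]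
  obtain r \<xi> where r: "strict_mono (r :: nat \<Rightarrow> nat)" and \<xi>: "\<xi> \<in> weak_directions_at_infinity B"
    and lim_v: "\<And>f :: 'a \<Rightarrow>\<^sub>L real. (\<lambda>n. f (v (r n))) \<longlonglongrightarrow> f \<xi>"
    by metis
  have F0: "F m \<xi> = 0" for m
  proof -
    have "(\<lambda>k. F m (v k)) \<longlonglongrightarrow> 0"
    proof (rule Lim_null_comparison[OF _ LIMSEQ_Suc[OF lim_1_over_n]])
      show "eventually (\<lambda>k. norm (F m (v k)) \<le> 1 / real (Suc k)) sequentially"
        using eventually_ge_at_top[of m]
      proof eventually_elim
        case (elim k)
        have "\<bar>F m (v k)\<bar> \<le> (\<Sum>m\<le>k. \<bar>F m (v k)\<bar>)"
          using elim by (intro member_le_sum) auto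
        then show ?case using v(3)[of k] by simp
      qed
    qed
    then have "(\<lambda>n. F m (v (r n))) \<longlonglongrightarrow> 0"
      using LIMSEQ_subseq_LIMSEQ[OF _ r] by (force simp: o_def)
    then show ?thesis using lim_v LIMSEQ_unique by blast
  qed
  have U_Y: "U \<subseteq> Y" unfolding Y_def by (meson closure_subset span_superset subset_trans)
  have "\<xi> \<in> Y"
  proof (rule mem_closed_convexI)
    show "closed Y" "convex Y" "Y \<noteq> {}"
      using U_Y by (auto simp: Y_def subspace_imp_convex U_def)
    fix f :: "'a \<Rightarrow>\<^sub>L real" and \<alpha> assume "\<And>c. c \<in> Y \<Longrightarrow> \<alpha> \<le> f c"
    then show "\<alpha> \<le> f \<xi>"
      using v(2) U_Y by (intro tendsto_lowerbound[OF lim_v]) (auto intro!: always_eventually)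
  qed
  moreover have "0 \<in> Y" using U_Y by (auto simp: U_def)
  ultimately have "\<xi> = 0" using sep[of \<xi> 0] F0 by simp
  then show False using \<xi> zero_no_direction by simp
qed

text \<open>
  Otherwise there are points \<open>l n *\<^sub>R d n + g n\<close> tending to \<open>0\<close>, with \<open>d n\<close> in the translate of \<open>C\<close> by
  \<open>- a\<close> and \<open>g n\<close> an average of far directions of mass \<open>1 - l n\<close>. Let \<open>l n\<close> tend to \<open>L\<close> and \<open>g n\<close> weakly to
  the recession direction \<open>z\<close>. If \<open>L > 0\<close>, then \<open>d n\<close> tends weakly to \<open>- z / L\<close>, and moving from
  \<open>a - z / L\<close> along \<open>z\<close> shows \<open>a \<in> C\<close>. If \<open>L = 0\<close>, the scaled points \<open>l n *\<^sub>R d n\<close> tend weakly to a recession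
  direction \<open>- z\<close>, so \<open>z = 0\<close> and \<open>far_combination_not_weakly_null\<close> applies.
\<close>

lemma hull_bounded_away_from_zero:
  assumes "a \<notin> C"
  obtains n \<delta> where "\<delta> > 0" "\<And>x. x \<in> convex hull ((\<lambda>c. c - a) ` C \<union> far_directions B n) \<Longrightarrow> \<delta> \<le> norm x"
proof (rule ccontr)
  define D where "D = (\<lambda>c. c - a) ` C"
  assume no: "\<not> thesis"
  have "\<exists>x\<in>convex hull (D \<union> far_directions B n). norm x < 1 / real (Suc n)" for n
    using no that[of "1 / real (Suc n)" n] unfolding D_def by (force simp: not_le)
  then obtain x where x: "\<And>n. x n \<in> convex hull (D \<union> far_directions B n)" "\<And>n. norm (x n) < 1 / real (Suc n)"
    by metis
  have D: "convex D" "D \<noteq> {}" using convex nonempty by (auto simp: D_def)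
  define decomposition where "decomposition n l d S w \<longleftrightarrow> 0 \<le> l \<and> d \<in> D \<and> finite S \<and>
      S \<subseteq> far_directions B n \<and> (\<forall>v\<in>S. 0 \<le> w v) \<and> l + sum w S = 1 \<and>
      x n = l *\<^sub>R d + (\<Sum>v\<in>S. w v *\<^sub>R v)" for n l d S w
  have "\<exists>l d S w. decomposition n l d S w" for n
    by (rule convex_hull_Un_explicit[OF D x(1)[of n]]) (unfold decomposition_def, blast)
  then obtain l d S w where dec: "\<And>n. decomposition n (l n) (d n) (S n) (w n)"
    by metis
  then have l0: "\<And>n. 0 \<le> l n" and d: "\<And>n. d n \<in> D"
    and S: "\<And>n. finite (S n)" "\<And>n. S n \<subseteq> far_directions B n" "\<And>n v. v \<in> S n \<Longrightarrow> 0 \<le> w n v"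
    and mass: "\<And>n. l n + sum (w n) (S n) = 1"
    and x_eq: "\<And>n. x n = l n *\<^sub>R d n + (\<Sum>v\<in>S n. w n v *\<^sub>R v)"
    unfolding decomposition_def by blast+
  have fw: "far_weights B S w"
    unfolding far_weights_def using S l0 mass by (metis le_add_same_cancel2)
  have l1: "l n \<le> 1" for n
    using sum_nonneg[of "S n" "w n"] S(3) mass[of n] by force
  define g where "g n = (\<Sum>v\<in>S n. w n v *\<^sub>R v)" for n
  have "norm (g n) \<le> 1" for n using norm_far_combination[OF fw] unfolding g_def .
  then obtain r z where r: "strict_mono (r :: nat \<Rightarrow> nat)"
    and z: "\<And>f :: 'a \<Rightarrow>\<^sub>L real. (\<lambda>n. f (g (r n))) \<longlonglongrightarrow> f z"
    using bounded_imp_weakly_convergent_subsequence[OF refl, of g 1] by blast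
  have "compact {0..1::real}" by simp
  then obtain s L where s: "strict_mono (s :: nat \<Rightarrow> nat)" and "L \<in> {0..1}" and L: "(\<lambda>n. l (r (s n))) \<longlonglongrightarrow> L"
    using l0 l1 unfolding compact_def by (force simp: o_def elim!: allE[of _ "\<lambda>n. l (r n)"])
  define q where "q n = r (s n)" for n
  have q: "strict_mono q" using strict_mono_o[OF r s] by (simp add: q_def o_def strict_mono_def)
  have z: "(\<lambda>n. f (\<Sum>v\<in>S (q n). w (q n) v *\<^sub>R v)) \<longlonglongrightarrow> f z" for f :: "'a \<Rightarrow>\<^sub>L real"
    using LIMSEQ_subseq_LIMSEQ[OF z s] by (simp add: o_def q_def g_def)
  have L: "(\<lambda>n. l (q n)) \<longlonglongrightarrow> L" using L by (simp add: q_def)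
  have fwq: "far_weights B (\<lambda>n. S (q n)) (\<lambda>n. w (q n))"
    by (rule far_weights_subseq[OF fw q order_refl])
  have z_recc: "z \<in> recc C" by (rule far_combination_limit_in_recc[OF fwq z])
  have x0: "x \<longlonglongrightarrow> 0"
    by (rule Lim_null_comparison[OF _ LIMSEQ_Suc[OF lim_1_over_n]])
      (use x(2) in \<open>auto intro!: always_eventually less_imp_le\<close>)
  have ld: "(\<lambda>n. l (q n) * f (d (q n))) \<longlonglongrightarrow> - f z" for f :: "'a \<Rightarrow>\<^sub>L real"
  proof -
    have "(\<lambda>n. f (x (q n))) \<longlonglongrightarrow> f 0"
      using LIMSEQ_subseq_LIMSEQ[OF x0 q] by (intro blinfun.tendsto tendsto_const) (simp add: o_def)
    from tendsto_diff[OF this z[of f]] show ?thesis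
      by (simp add: x_eq blinfun.add_right blinfun.scaleR_right)
  qed
  have fd: "\<alpha> - f a \<le> f (d n)" if "\<And>c. c \<in> C \<Longrightarrow> \<alpha> \<le> f c" for f :: "'a \<Rightarrow>\<^sub>L real" and \<alpha> n
    using d[of n] that by (auto simp: D_def blinfun.diff_right)
  have bound: "L * (\<alpha> - f a) \<le> - f z" if "\<And>c. c \<in> C \<Longrightarrow> \<alpha> \<le> f c" for f :: "'a \<Rightarrow>\<^sub>L real" and \<alpha>
  proof (rule LIMSEQ_le[OF _ ld])
    show "(\<lambda>n. l (q n) * (\<alpha> - f a)) \<longlonglongrightarrow> L * (\<alpha> - f a)" by (intro tendsto_intros L)
    show "\<exists>N. \<forall>n\<ge>N. l (q n) * (\<alpha> - f a) \<le> l (q n) * f (d (q n))"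
      using fd[OF that] l0 by (intro exI allI impI mult_left_mono) auto
  qed
  show False
  proof (cases "L = 0")
    case True
    have "- z \<in> recc C"
      by (rule mem_reccI[OF closed convex]) (use bound True in \<open>fastforce simp: blinfun.minus_right\<close>)
    then have "z = 0" using opposite_recession_zero z_recc by blast
    have "(\<lambda>n. 1 - l (q n)) \<longlonglongrightarrow> 1 - 0" using L True by (intro tendsto_intros) simp
    moreover have "1 - l (q n) = sum (w (q n)) (S (q n))" for n using mass[of "q n"] by simp
    ultimately have "(\<lambda>n. sum (w (q n)) (S (q n))) \<longlonglongrightarrow> 1" by simp
    then show False
      using far_combination_not_weakly_null[OF fwq] z \<open>z = 0\<close> by simp
  next
    case False
    then have "L > 0" using \<open>L \<in> {0..1}\<close> by simp
    have "a - (1 / L) *\<^sub>R z \<in> C"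
    proof (rule mem_closed_convexI[OF closed convex nonempty])
      fix f :: "'a \<Rightarrow>\<^sub>L real" and \<alpha> assume "\<And>c. c \<in> C \<Longrightarrow> \<alpha> \<le> f c"
      from bound[OF this] show "\<alpha> \<le> f (a - (1 / L) *\<^sub>R z)"
        using \<open>L > 0\<close> by (simp add: blinfun.diff_right blinfun.scaleR_right field_simps)
    qed
    then have "a - (1 / L) *\<^sub>R z + (1 / L) *\<^sub>R z \<in> C"
      using z_recc \<open>L > 0\<close> unfolding recc_def by (metis (no_types, lifting) divide_nonneg_pos mem_Collect_eq zero_le_one)
    then show False using \<open>a \<notin> C\<close> by simp
  qed
qed

text \<open>
  One functional has to separate \<open>a\<close> from \<open>C\<close> and be positive on the far directions at once. It is then
  positive on all points of \<open>B\<close> of large norm, and bounded on the others.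
\<close>

lemma separating_functional_bounded_below:
  assumes "a \<notin> C"
  obtains f :: "'a \<Rightarrow>\<^sub>L real" and \<delta> m where "\<delta> > 0" "\<And>c. c \<in> C \<Longrightarrow> f a + \<delta> \<le> f c" "\<And>b. b \<in> B \<Longrightarrow> m \<le> f b"
proof -
  obtain n \<delta> where "\<delta> > 0"
    and far: "\<And>x. x \<in> convex hull ((\<lambda>c. c - a) ` C \<union> far_directions B n) \<Longrightarrow> \<delta> \<le> norm x"
    by (rule hull_bounded_away_from_zero[OF assms]) (rule that)
  obtain f :: "'a \<Rightarrow>\<^sub>L real" where "norm f \<le> 1"
    and f: "\<And>x. x \<in> convex hull ((\<lambda>c. c - a) ` C \<union> far_directions B n) \<Longrightarrow> \<delta> \<le> f x"
    by (rule separating_functional[OF convex_convex_hull _ far]) (use nonempty in auto)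
  have f': "\<delta> \<le> f x" if "x \<in> (\<lambda>c. c - a) ` C \<union> far_directions B n" for x
    using f hull_subset[of _ convex] that by (metis subsetD)
  have "f a + \<delta> \<le> f c" if "c \<in> C" for c
    using f'[of "c - a"] that by (simp add: blinfun.diff_right)
  moreover have "- real n \<le> f b" if "b \<in> B" for b
  proof (cases "real n \<le> norm b \<and> b \<noteq> 0")
    case True
    then have "\<delta> \<le> f (b /\<^sub>R norm b)"
      using \<open>b \<in> B\<close> by (intro f') (auto simp: far_directions_def)
    then have "0 < f b / norm b" using \<open>\<delta> > 0\<close> by (simp add: blinfun.scaleR_right divide_inverse mult.commute)
    then have "0 < f b" using True by (simp add: zero_less_divide_iff)
    then show ?thesis by linarith
  next
    case False
    have "\<bar>f b\<bar> \<le> norm b"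
      using norm_blinfun[of f b] mult_right_mono[OF \<open>norm f \<le> 1\<close> norm_ge_zero[of b]] by simp
    then show ?thesis using False by auto
  qed
  ultimately show thesis using that \<open>\<delta> > 0\<close> by blast
qed

end

section \<open>The cancellation law\<close>

lemma weak_closure_functional_ge:
  fixes f :: "'a::real_normed_vector \<Rightarrow>\<^sub>L real"
  assumes "x \<in> weak_topology closure_of S" and le: "\<And>s. s \<in> S \<Longrightarrow> r \<le> f s"
  shows "r \<le> f x"
proof (rule ccontr)
  assume "\<not> r \<le> f x"
  then have "x \<in> blinfun_apply f -` {..<r}" by simp
  moreover have "openin weak_topology (blinfun_apply f -` {..<r})"
    by (intro openin_weak_topology_vimage) simp
  moreover have nb: "\<forall>T. x \<in> T \<and> openin weak_topology T \<longrightarrow> (\<exists>y. y \<in> S \<and> y \<in> T)"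
    using assms(1) by (simp add: in_closure_of)
  ultimately have "\<exists>y. y \<in> S \<and> y \<in> blinfun_apply f -` {..<r}"
    by (intro nb[rule_format] conjI)
  then obtain s where "s \<in> S" "f s < r" by auto
  then show False using le[of s] by simp
qed

theorem theorem4p11:
  fixes A B C V :: "'a::banach set"
  assumes "reflexive_space TYPE('a)"
    and "closed C" and "convex C"
    and "B \<noteq> {}"
    and "0 \<notin> weak_directions_at_infinity B"
    and "weak_asymptotic_cone B \<subseteq> recc C"
    and "recc C = V"
    and "pointed_cone V"
    and "A + B \<subseteq> weak_topology closure_of (B + C)"
  shows "A \<subseteq> C"
proof
  fix a assume "a \<in> A"
  obtain b where "b \<in> B" using \<open>B \<noteq> {}\<close> by blast
  have in_closure: "a + b \<in> weak_topology closure_of (B + C)" if "b \<in> B" for b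
    using assms(9) \<open>a \<in> A\<close> that by blast
  have "C \<noteq> {}"
  proof
    assume "C = {}"
    then have "B + C = {}" by (auto elim: set_plus_elim)
    then show False using in_closure[OF \<open>b \<in> B\<close>] by simp
  qed
  then interpret pointed_recession B C
    using assms by unfold_locales auto
  show "a \<in> C"
  proof (rule ccontr)
    assume "a \<notin> C"
    obtain f :: "'a \<Rightarrow>\<^sub>L real" and \<delta> m where "\<delta> > 0" and fC: "\<And>c. c \<in> C \<Longrightarrow> f a + \<delta> \<le> f c"
      and fB: "\<And>b. b \<in> B \<Longrightarrow> m \<le> f b"
      by (rule separating_functional_bounded_below[OF \<open>a \<notin> C\<close>]) (rule that)
    define \<mu> where "\<mu> = Inf (f ` B)"
    have bdd: "bdd_below (f ` B)" using fB by (auto intro!: bdd_belowI)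
    \<comment> \<open>The inclusion pushes \<open>a + B\<close> up by \<open>\<delta>\<close> more than \<open>f a\<close>, so the finite infimum of \<open>f\<close> over \<open>B\<close>
      would exceed itself by \<open>\<delta>\<close>.\<close>
    have "\<mu> + \<delta> \<le> f b" if "b \<in> B" for b
    proof -
      have "\<mu> + (f a + \<delta>) \<le> f (a + b)"
      proof (rule weak_closure_functional_ge[OF in_closure[OF that]])
        fix s assume "s \<in> B + C"
        then obtain b c where "s = b + c" "b \<in> B" "c \<in> C" by (rule set_plus_elim)
        then show "\<mu> + (f a + \<delta>) \<le> f s"
          using fC cInf_lower[OF _ bdd] unfolding \<mu>_def by (auto simp: blinfun.add_right intro!: add_mono)
      qed
      then show ?thesis by (simp add: blinfun.add_right)
    qed
    then have "\<mu> + \<delta> \<le> \<mu>"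
      unfolding \<mu>_def using \<open>B \<noteq> {}\<close> by (intro cInf_greatest[of "f ` B" "Inf (f ` B) + \<delta>"]) auto
    then show False using \<open>\<delta> > 0\<close> by simp
  qed
qed

end
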